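(* Let $s,k \in \mathbb{N}$ with $k \geq 2$ and let $r = s(k-1)$. For every $r$-edge-colouring of the complete $k$-uniform hypergraph $\mathcal{K}_{\mathbb{N}}^{(k)}$ (vertex set $\mathbb{N}$, edge set $\binom{\mathbb{N}}{k}$), the vertex set $\mathbb{N}$ can be core-partitioned into $s$ monochromatic Berge-paths (finite or infinite) of pairwise different colours.
   Context: A $k$-graph is a pair $(V,\mathcal{E})$ with $\mathcal{E} \subseteq \binom{V}{k}$. For integers $2 \le t \le k$ and $\ell \ge 1$, a finite $t$-tight Berge-path of length $\ell$ in a $k$-graph is a pair $(X,F)$ where $X=\{v_1,\dots,v_{\ell+t-1}\}$ is a set of $\ell+t-1$ distinct vertices, $F=\{e_1,\dots,e_\ell\}$ is a set of $\ell$ distinct edges, and $v_i,v_{i+1},\dots,v_{i+t-1} \in e_i$ for all $i\in[\ell]$. A $t$-tight Berge-path of length $0$ is a pair $(\{v\},\emptyset)$. An infinite $t$-tight Berge-path is a pair $(X,F)$ with $X=\{v_i : i\in\mathbb{N}\}$ (distinct vertices), $F=\{e_i: i\in\mathbb{N}\}$ (distinct edges) and $v_i,\dots,v_{i+t-1}\in e_i$ for all $i$. $X$ is called the core of the path. A $2$-tight Berge-path is called a Berge-path. Paths $(X_1,F_1),\dots,(X_s,F_s)$ core-partition $V$ if $X_1\cup\dots\cup X_s$ is a partition of $V$. Given an edge-colouring $\varphi$, a path $(X,F)$ is monochromatic in colour $c$ if $\varphi(f)=c$ for all $f\in F$. *)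

theory Defs
  imports Main "HOL-Library.Ramsey" "HOL-Library.Disjoint_Sets"
begin

type_synonym 'a hypergraph = "'a set \<times> 'a set set"

definition complete_k_graph :: "nat \<Rightarrow> 'a set \<Rightarrow> 'a hypergraph" where
  "complete_k_graph k V = (V, nsets V k)"

text \<open>A path is a pair (core, edge set). Vertices and edges along it are indexed from 0,
  so the \<open>t\<close> consecutive vertices lying in the edge \<open>e i\<close> are \<open>v i, \<dots>, v (i + t - 1)\<close>.
  The notions are meant for \<open>k\<close>-graphs with \<open>2 \<le> t \<le> k\<close>. A path of length 0 is a
  single vertex, so cores are never empty.\<close>

type_synonym 'a path = "'a set \<times> 'a set set"

definition finite_tight_berge_path :: "nat \<Rightarrow> 'a hypergraph \<Rightarrow> nat \<Rightarrow> 'a path \<Rightarrow> bool" where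
  "finite_tight_berge_path t H l P \<longleftrightarrow>
    (if l = 0 then \<exists>v \<in> fst H. P = ({v}, {})
     else \<exists>v e. inj_on v {..<l + t - 1} \<and> inj_on e {..<l} \<and>
            P = (v ` {..<l + t - 1}, e ` {..<l}) \<and>
            fst P \<subseteq> fst H \<and> snd P \<subseteq> snd H \<and>
            (\<forall>i<l. v ` {i..<i + t} \<subseteq> e i))"

definition infinite_tight_berge_path :: "nat \<Rightarrow> 'a hypergraph \<Rightarrow> 'a path \<Rightarrow> bool" where
  "infinite_tight_berge_path t H P \<longleftrightarrow>
    (\<exists>(v :: nat \<Rightarrow> 'a) (e :: nat \<Rightarrow> 'a set). inj v \<and> inj e \<and>
       P = (range v, range e) \<and> fst P \<subseteq> fst H \<and> snd P \<subseteq> snd H \<and>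
       (\<forall>i. v ` {i..<i + t} \<subseteq> e i))"

definition tight_berge_path :: "nat \<Rightarrow> 'a hypergraph \<Rightarrow> 'a path \<Rightarrow> bool" where
  "tight_berge_path t H P \<longleftrightarrow>
    (\<exists>l. finite_tight_berge_path t H l P) \<or> infinite_tight_berge_path t H P"

definition berge_path :: "'a hypergraph \<Rightarrow> 'a path \<Rightarrow> bool" where
  "berge_path = tight_berge_path 2"

definition edge_colouring :: "nat \<Rightarrow> 'a hypergraph \<Rightarrow> ('a set \<Rightarrow> nat) \<Rightarrow> bool" where
  "edge_colouring r H \<phi> \<longleftrightarrow> \<phi> ` snd H \<subseteq> {1..r}"

text \<open>A path of length 0 is monochromatic in every colour.\<close>

definition monochromatic_in :: "('a set \<Rightarrow> nat) \<Rightarrow> nat \<Rightarrow> 'a path \<Rightarrow> bool" where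
  "monochromatic_in \<phi> c P \<longleftrightarrow> (\<forall>f \<in> snd P. \<phi> f = c)"

definition core_partition :: "'a set \<Rightarrow> nat \<Rightarrow> (nat \<Rightarrow> 'a path) \<Rightarrow> bool" where
  "core_partition V s P \<longleftrightarrow>
    disjoint_family_on (\<lambda>i. fst (P i)) {1..s} \<and> (\<Union>i\<in>{1..s}. fst (P i)) = V"

end

theory Submission
  imports Defs "HOL-Library.Diagonal_Subsequence" "HOL-Library.Sublist"
begin

text \<open>
  Choose a sequence \<open>\<sigma>\<close> along which, for every \<open>(k - 1)\<close>-set \<open>S\<close>, the colour of \<open>S \<union> {\<sigma> n}\<close> is
  eventually constant. Call a colour \<open>c\<close> good for \<open>x\<close> if for all large \<open>n\<close> some edge of colour \<open>c\<close>
  contains \<open>x\<close> and \<open>\<sigma> n\<close>. Any \<open>k - 1\<close> vertices have a common good colour. If none of \<open>k - 1\<close>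
  disjoint blocks of \<open>s\<close> colours contained a good colour for every vertex, witnesses
  \<open>x\<^sub>1, \<dots>, x\<^sub>k\<^sub>-\<^sub>1\<close> of this would have no common good colour; hence some \<open>s\<close> colours suffice.

  Two vertices \<open>x, z\<close> for which \<open>c\<close> is good can be joined avoiding any finite set of vertices and
  edges: for large \<open>n\<close> take unused edges \<open>e \<supseteq> {x, \<sigma> n}\<close> and \<open>f \<supseteq> {\<sigma> n, z}\<close> of colour \<open>c\<close>; if
  \<open>e \<noteq> f\<close> go through \<open>\<sigma> n\<close>, and if \<open>e = f\<close> this edge joins \<open>x\<close> to \<open>z\<close> directly. So, as in Rado's
  theorem for graphs, the paths can be grown greedily, each time absorbing the least vertex not
  yet covered.
\<close>

section \<open>Finite Berge-paths as lists, and their limits\<close>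

lemma prefix_chain_limit:
  assumes "\<And>n. prefix (xs n) (xs (Suc n))"
  obtains v where "\<And>n. xs n = map v [0..<length (xs n)]"
proof -
  have mono: "prefix (xs m) (xs n)" if "m \<le> n" for m n
    using that by (induction rule: dec_induct) (auto intro: prefix_order.trans assms)
  have same: "xs m ! i = xs n ! i" if "i < length (xs m)" "i < length (xs n)" for m n i
  proof (cases "m \<le> n")
    case True
    then show ?thesis using mono[of m n] that by (auto simp: prefix_def nth_append)
  next
    case False
    then show ?thesis using mono[of n m] that by (auto simp: prefix_def nth_append)
  qed
  \<comment> \<open>Any list longer than \<open>i\<close> will do, since lists of the chain agree on
    common indices. If none is that long, \<open>v i\<close> is arbitrary and never read.\<close>
  define v where "v i = xs (SOME n. i < length (xs n)) ! i" for i
  have "xs n ! i = v i" if "i < length (xs n)" for n i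
    unfolding v_def by (rule same[OF that]) (rule someI[of _ n], rule that)
  then have "xs n = map v [0..<length (xs n)]" for n
    by (intro nth_equalityI) auto
  then show thesis by (rule that)
qed

text \<open>Lists keep the order along the path, so growing it means extending a prefix. With
  \<open>E\<close> a colour class the path is monochromatic; \<open>es = []\<close> is length
  0.\<close>

definition berge_list :: "'a set set \<Rightarrow> 'a list \<Rightarrow> 'a set list \<Rightarrow> bool" where
  "berge_list E vs es \<longleftrightarrow> length vs = Suc (length es) \<and> distinct vs \<and> distinct es \<and>
     set es \<subseteq> E \<and> (\<forall>i<length es. {vs ! i, vs ! Suc i} \<subseteq> es ! i)"

lemma berge_list_snoc:
  assumes "berge_list E vs es" "x \<notin> set vs" "e \<notin> set es" "e \<in> E" "{last vs, x} \<subseteq> e"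
  shows "berge_list E (vs @ [x]) (es @ [e])"
proof -
  have "vs \<noteq> []" and len: "length vs = Suc (length es)"
    using assms(1) by (auto simp: berge_list_def)
  then have "last vs = vs ! length es" by (simp add: last_conv_nth)
  then show ?thesis
    using assms len by (auto simp: berge_list_def nth_append less_Suc_eq)
qed

text \<open>A path may stop growing or grow forever, so the limit is finite or infinite according to
  whether the lengths are bounded.\<close>

lemma berge_path_limit:
  assumes valid: "\<And>n. berge_list E (vs n) (es n)"
    and chain: "\<And>n. prefix (vs n) (vs (Suc n))" "\<And>n. prefix (es n) (es (Suc n))"
    and H: "\<And>n. set (vs n) \<subseteq> fst H" "E \<subseteq> snd H"
  shows "berge_path H (\<Union>n. set (vs n), \<Union>n. set (es n))" (is "berge_path H ?P")
proof -
  obtain v where v: "\<And>n. vs n = map v [0..<length (vs n)]"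
    using prefix_chain_limit[of vs] chain by blast
  obtain e where e: "\<And>n. es n = map e [0..<length (es n)]"
    using prefix_chain_limit[of es] chain by blast
  define L where "L n = length (es n)" for n
  have vs: "vs n = map v [0..<Suc (L n)]" for n
    using v[of n] valid[of n] by (simp add: berge_list_def L_def)
  have es: "es n = map e [0..<L n]" for n
    using e[of n] by (simp add: L_def)
  have set_vs: "set (vs n) = v ` {..<Suc (L n)}" and set_es: "set (es n) = e ` {..<L n}" for n
    unfolding vs es by (simp_all only: set_map set_upt atLeast0LessThan)
  have injv: "inj_on v {..<Suc (L n)}" for n
    using valid[of n] unfolding berge_list_def vs
    by (simp only: distinct_map set_upt atLeast0LessThan)
  have inje: "inj_on e {..<L n}" for n
    using valid[of n] unfolding berge_list_def es
    by (simp only: distinct_map set_upt atLeast0LessThan)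
  have step: "v ` {i..<i + 2} \<subseteq> e i" if "i < L n" for n i
  proof -
    have "{i..<i + 2} = {i, Suc i}" by auto
    moreover have "{vs n ! i, vs n ! Suc i} \<subseteq> es n ! i"
      using valid[of n] that by (simp add: berge_list_def L_def)
    ultimately show ?thesis
      using that unfolding vs es by (simp del: upt_Suc)
  qed
  have sub: "fst ?P \<subseteq> fst H" "snd ?P \<subseteq> snd H"
    using valid H by (force simp: berge_list_def)+
  show ?thesis
  proof (cases "\<exists>b. \<forall>n. L n \<le> b")
    case True
    then have "finite (range L)" by (auto intro: finite_subset[of _ "{..b}" for b])
    then have "Max (range L) \<in> range L" and max: "\<And>n. L n \<le> Max (range L)"
      by (auto intro: Max_in)
    then obtain m where m: "\<And>n. L n \<le> L m" by (metis imageE)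
    \<comment> \<open>The longest stage \<open>m\<close> already contains the whole union.\<close>
    have P: "?P = (v ` {..<Suc (L m)}, e ` {..<L m})"
    proof -
      have "(\<Union>n. {..<Suc (L n)}) = {..<Suc (L m)}" "(\<Union>n. {..<L n}) = {..<L m}"
        using m by (auto simp: less_Suc_eq_le intro: le_trans less_le_trans)
      then show ?thesis unfolding set_vs set_es by (metis image_UN)
    qed
    have "finite_tight_berge_path 2 H (L m) ?P"
    proof (cases "L m = 0")
      case True
      then show ?thesis using sub(1)
        unfolding finite_tight_berge_path_def P by (simp add: lessThan_Suc)
    next
      case False
      then show ?thesis using sub injv[of m] inje[of m] step[of _ m]
        unfolding finite_tight_berge_path_def P
        by simp blast
    qed
    then show ?thesis unfolding berge_path_def tight_berge_path_def by blast
  next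
    case False
    then have unb: "\<exists>n. i < L n" for i by (meson leI)
    \<comment> \<open>Any two indices lie below the length of one common stage, where injectivity is
      known.\<close>
    have inj: "inj v" "inj e"
    proof -
      have "\<exists>n. i < L n \<and> j < L n" for i j
        using unb[of "max i j"] by auto
      then show "inj v" "inj e"
        using injv inje by (metis inj_def inj_onD lessThan_iff less_SucI)+
    qed
    have P: "?P = (range v, range e)"
      unfolding set_vs set_es prod.inject using unb by (blast intro: less_SucI)
    have "infinite_tight_berge_path 2 H ?P"
      using inj sub unb step unfolding infinite_tight_berge_path_def P by blast
    then show ?thesis unfolding berge_path_def tight_berge_path_def by blast
  qed
qed

section \<open>Diagonal subsequences\<close>

text \<open>Enumerate \<open>I\<close>, thin out the sequence once per index by the pigeonhole
  principle, and take the diagonal.\<close>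

lemma eventually_constant_subsequence:
  fixes h :: "'i \<Rightarrow> nat \<Rightarrow> 'b"
  assumes "countable I" and fin: "\<And>i. i \<in> I \<Longrightarrow> finite (range (h i))"
  obtains \<sigma> :: "nat \<Rightarrow> nat"
  where "strict_mono \<sigma>" "\<And>i. i \<in> I \<Longrightarrow> \<exists>c. \<forall>\<^sub>F n in sequentially. h i (\<sigma> n) = c"
proof (cases "I = {}")
  case True
  then show thesis using that[of id] by (simp add: strict_mono_def)
next
  case False
  let ?h = "\<lambda>n. h (from_nat_into I n)"
  define P where "P n s \<longleftrightarrow> (\<exists>c. \<forall>i. ?h n (s i) = c)" for n and s :: "nat \<Rightarrow> nat"
  interpret subseqs P
  proof
    fix n :: nat and s :: "nat \<Rightarrow> nat"
    have "finite (range (?h n \<circ> s))"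
      using fin[OF from_nat_into[OF False]] by (rule finite_subset[rotated]) auto
    then obtain a where a: "infinite {i. (?h n \<circ> s) i = (?h n \<circ> s) a}"
      using pigeonhole_infinite[of UNIV "?h n \<circ> s"] by auto
    then obtain r :: "nat \<Rightarrow> nat" where "strict_mono r" "\<forall>i. r i \<in> {i. (?h n \<circ> s) i = (?h n \<circ> s) a}"
      using infinite_enumerate by blast
    then show "\<exists>r. strict_mono r \<and> P n (s \<circ> r)"
      unfolding P_def by (intro exI[of _ r]) auto
  qed
  have "\<exists>c. \<forall>\<^sub>F n in sequentially. h i (diagseq n) = c" if "i \<in> I" for i
  proof -
    obtain m where m: "from_nat_into I m = i"
      using \<open>i \<in> I\<close> assms(1) by (metis from_nat_into_surj)
    \<comment> \<open>Past position \<open>m\<close> the diagonal is a subsequence of the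
      \<open>m\<close>-th refinement, and constancy passes to subsequences.\<close>
    have "P m (diagseq \<circ> (+) (Suc m))"
      by (rule diagseq_holds) (auto simp: P_def)
    then obtain c where c: "\<And>i'. h i (diagseq (Suc m + i')) = c"
      unfolding P_def m by auto
    have "h i (diagseq n) = c" if "n \<ge> Suc m" for n
      using c[of "n - Suc m"] that by simp
    then show ?thesis unfolding eventually_sequentially by blast
  qed
  then show thesis using that subseq_diagseq by blast
qed

section \<open>Greedy growth of the paths\<close>

lemma partition_into_berge_paths:
  fixes g :: "nat \<Rightarrow> 'c" and E :: "'c \<Rightarrow> nat set set"
  assumes connect: "\<And>x z W F. x \<noteq> z \<Longrightarrow> g x = g z \<Longrightarrow> finite W \<Longrightarrow> finite F \<Longrightarrow>
      (\<exists>e \<in> E (g z) - F. {x, z} \<subseteq> e) \<or>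
      (\<exists>y e f. y \<notin> W \<and> e \<in> E (g z) - F \<and> f \<in> E (g z) - F \<and> e \<noteq> f \<and> {x, y} \<subseteq> e \<and> {y, z} \<subseteq> f)"
    and fin: "finite (range g)"
    and E: "\<And>c. E c \<subseteq> snd H" "fst H = UNIV"
  shows "\<exists>P. disjoint_family_on (\<lambda>c. fst (P c)) (range g) \<and> (\<Union>c\<in>range g. fst (P c)) = UNIV \<and>
    (\<forall>c \<in> range g. berge_path H (P c) \<and> snd (P c) \<subseteq> E c)"
proof -
  \<comment> \<open>Only the end vertex of path \<open>c\<close> must have \<open>g\<close>-value
    \<open>c\<close>, so that \<open>connect\<close> applies to it; intermediate vertices may have
    any value.\<close>
  define Inv where "Inv st \<longleftrightarrow> (\<forall>c \<in> range g. berge_list (E c) (fst (st c)) (snd (st c)) \<and>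
      g (last (fst (st c))) = c) \<and> disjoint_family_on (\<lambda>c. set (fst (st c))) (range g)"
    for st :: "'c \<Rightarrow> nat list \<times> nat set list"
  define cov where "cov st = (\<Union>c\<in>range g. set (fst (st c)))"
    for st :: "'c \<Rightarrow> nat list \<times> nat set list"
  define ext where "ext st st' \<longleftrightarrow> (\<forall>c. prefix (fst (st c)) (fst (st' c)) \<and> prefix (snd (st c)) (snd (st' c)))"
    for st st' :: "'c \<Rightarrow> nat list \<times> nat set list"
  have extend: "\<exists>st'. Inv st' \<and> ext st st' \<and> z \<in> cov st'" if Inv: "Inv st" for st z
  proof (cases "z \<in> cov st")
    case True
    then show ?thesis using Inv by (auto simp: ext_def)
  next
    case False
    obtain vs es where st: "st (g z) = (vs, es)" by fastforce
    have bl: "berge_list (E (g z)) vs es" and gl: "g (last vs) = g z"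
      and dis: "disjoint_family_on (\<lambda>c. set (fst (st c))) (range g)"
      using Inv st unfolding Inv_def by (metis fst_conv snd_conv rangeI)+
    have "vs \<noteq> []" using bl by (auto simp: berge_list_def)
    have vs: "set vs \<subseteq> cov st" using st unfolding cov_def by (metis UN_upper fst_conv rangeI)
    have "last vs \<noteq> z" using False vs \<open>vs \<noteq> []\<close> last_in_set by blast
    have *: "\<exists>st'. Inv st' \<and> ext st st' \<and> z \<in> cov st'"
      if new: "berge_list (E (g z)) (vs @ us @ [z]) (es @ fs)" "set us \<inter> cov st = {}" for us fs
    proof (intro exI conjI)
      let ?st' = "st(g z := (vs @ us @ [z], es @ fs))"
      have "disjoint_family_on (\<lambda>c. set (fst (?st' c))) (range g)"
        unfolding disjoint_family_on_def
      proof (intro ballI impI)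
        fix c d assume cd: "c \<in> range g" "d \<in> range g" "c \<noteq> d"
        have "set (fst (st c)) \<inter> set (fst (st d)) = {}"
          using dis cd unfolding disjoint_family_on_def by blast
        moreover have "set (fst (st c)) \<subseteq> cov st" "set (fst (st d)) \<subseteq> cov st"
          using cd unfolding cov_def by blast+
        ultimately show "set (fst (?st' c)) \<inter> set (fst (?st' d)) = {}"
          using cd(3) st new(2) False by auto
      qed
      then show "Inv ?st'" using Inv new(1) by (simp add: Inv_def)
      show "ext st ?st'" by (simp add: ext_def st)
      show "z \<in> cov ?st'" by (force simp: cov_def)
    qed
    \<comment> \<open>\<open>W\<close> also contains \<open>z\<close>, so the intermediate vertex
      differs from \<open>z\<close> as well as from all covered vertices.\<close>
    have "finite (insert z (cov st))" using fin unfolding cov_def by blast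
    from connect[OF \<open>last vs \<noteq> z\<close> gl this finite_set[of es]]
    show ?thesis
    proof (elim disjE bexE exE conjE)
      fix e assume "e \<in> E (g z) - set es" "{last vs, z} \<subseteq> e"
      then have "berge_list (E (g z)) (vs @ [z]) (es @ [e])"
        using berge_list_snoc[OF bl] vs False by auto
      then show ?thesis using *[of "[]" "[e]"] by simp
    next
      fix y e f
      assume y: "y \<notin> insert z (cov st)" and ef: "e \<in> E (g z) - set es" "f \<in> E (g z) - set es"
        "e \<noteq> f" "{last vs, y} \<subseteq> e" "{y, z} \<subseteq> f"
      have "berge_list (E (g z)) (vs @ [y]) (es @ [e])"
        using berge_list_snoc[OF bl] vs y ef by auto
      then have "berge_list (E (g z)) ((vs @ [y]) @ [z]) ((es @ [e]) @ [f])"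
        by (rule berge_list_snoc) (use vs False y ef in auto)
      then show ?thesis using *[of "[y]" "[e, f]"] y by simp
    qed
  qed
  let ?st0 = "\<lambda>c. ([inv g c], [] :: nat set list)"
  have init: "Inv ?st0"
    by (auto simp: Inv_def berge_list_def disjoint_family_on_def f_inv_into_f) (metis f_inv_into_f rangeI)
  \<comment> \<open>Stage \<open>n\<close> absorbs vertex \<open>n\<close> unless it is covered
    already, so the limit covers everything.\<close>
  obtain st where st: "\<And>n. Inv (st n)" "\<And>n. ext (st n) (st (Suc n)) \<and> n \<in> cov (st (Suc n))"
    using dependent_nat_choice[of "\<lambda>_. Inv" "\<lambda>n s s'. ext s s' \<and> n \<in> cov s'"] init extend by metis
  have mono: "ext (st m) (st n)" if "m \<le> n" for m n
    using that
  proof (induction rule: dec_induct)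
    case base
    then show ?case by (simp add: ext_def)
  next
    case (step n)
    then show ?case using st(2)[of n] unfolding ext_def by (meson prefix_order.trans)
  qed
  define P where "P c = (\<Union>n. set (fst (st n c)), \<Union>n. set (snd (st n c)))" for c
  show ?thesis
  proof (intro exI conjI ballI)
    show "disjoint_family_on (\<lambda>c. fst (P c)) (range g)"
      unfolding disjoint_family_on_def
    proof (intro ballI impI)
      fix c d assume cd: "c \<in> range g" "d \<in> range g" "c \<noteq> d"
      \<comment> \<open>Both cores only grow, so they can be compared at the later of the two
        stages.\<close>
      have "set (fst (st m c)) \<inter> set (fst (st n d)) = {}" for m n
      proof -
        have "set (fst (st m c)) \<subseteq> set (fst (st (max m n) c))"
          "set (fst (st n d)) \<subseteq> set (fst (st (max m n) d))"
          using mono[of m "max m n"] mono[of n "max m n"]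
          by (auto simp: ext_def dest: set_mono_prefix)
        then show ?thesis
          using st(1)[of "max m n"] cd unfolding Inv_def disjoint_family_on_def by blast
      qed
      then show "fst (P c) \<inter> fst (P d) = {}" by (auto simp: P_def)
    qed
    show "(\<Union>c\<in>range g. fst (P c)) = UNIV"
      using st(2) by (fastforce simp: P_def cov_def)
    fix c assume c: "c \<in> range g"
    show "berge_path H (P c)"
      unfolding P_def
      by (rule berge_path_limit[where E = "E c"])
        (use st c E in \<open>auto simp: Inv_def ext_def\<close>)
    show "snd (P c) \<subseteq> E c"
      using st(1) c by (force simp: P_def Inv_def berge_list_def)
  qed
qed

text \<open>
  Cores must be nonempty, so colours assigned to no vertex are given one vertex each. Such a vertex
  is alone in its class, and vertices sharing a class keep their original colour.
\<close>
lemma surjective_modification: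
  fixes g :: "'a \<Rightarrow> 'c"
  assumes "finite T" "range g \<subseteq> T" "infinite (UNIV :: 'a set)"
  obtains g' where "range g' = T"
    "\<And>x z. x \<noteq> z \<Longrightarrow> g' x = g' z \<Longrightarrow> g x = g' x \<and> g z = g' z"
proof -
  \<comment> \<open>One preimage of each used colour is reserved; recolouring \<open>D\<close>
    outside them loses no colour.\<close>
  let ?R = "inv g ` range g"
  have finR: "finite ?R" using assms by (meson finite_imageI finite_subset)
  have "infinite (UNIV - ?R)" using assms(3) finR by simp
  then obtain D where D: "D \<subseteq> UNIV - ?R" "finite D" "card D = card (T - range g)"
    using infinite_arbitrarily_large by metis
  obtain f where f: "bij_betw f D (T - range g)"
    using finite_same_card_bij[OF D(2) _ D(3)] assms(1) by blast
  define g' where "g' x = (if x \<in> D then f x else g x)" for x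
  have fD: "f ` D = T - range g" and finj: "inj_on f D" using f by (auto simp: bij_betw_def)
  have "range g' = T"
  proof
    show "range g' \<subseteq> T" using assms(2) fD by (auto simp: g'_def)
    show "T \<subseteq> range g'"
    proof
      fix c assume "c \<in> T"
      show "c \<in> range g'"
      proof (cases "c \<in> range g")
        case True
        then have "inv g c \<notin> D" using D by blast
        then have "g' (inv g c) = c" using True by (simp add: g'_def f_inv_into_f)
        then show ?thesis by (metis rangeI)
      next
        case False
        then have "c \<in> f ` D" using fD \<open>c \<in> T\<close> by simp
        then obtain x where "x \<in> D" "f x = c" by auto
        then have "g' x = c" by (simp add: g'_def)
        then show ?thesis by (metis rangeI)
      qed
    qed
  qed
  moreover have "g x = g' x \<and> g z = g' z" if "x \<noteq> z" "g' x = g' z" for x z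
  proof -
    \<comment> \<open>New values avoid \<open>range g\<close> and are distinct on \<open>D\<close>,
      so distinct vertices with equal \<open>g'\<close>-value both lie outside
      \<open>D\<close>.\<close>
    have "f w \<noteq> g u \<and> g u \<noteq> f w" if "w \<in> D" for w u
      using fD imageI[OF that, of f] by (metis DiffD2 rangeI)
    then show ?thesis using that finj
      by (cases "x \<in> D"; cases "z \<in> D") (auto simp: g'_def dest: inj_onD)
  qed
  ultimately show thesis using that by blast
qed

section \<open>Choice of the colours\<close>

text \<open>\<open>common\<close> speaks of \<open>card X \<le> m\<close> because the witnesses of
  the \<open>m\<close> failing blocks may coincide.\<close>

lemma small_transversal:
  fixes good :: "nat \<Rightarrow> 'a \<Rightarrow> bool"
  assumes "s \<ge> 1"
    and common: "\<And>X. finite X \<Longrightarrow> card X \<le> m \<Longrightarrow> \<exists>c\<in>{1..s * m}. \<forall>x\<in>X. good c x"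
  obtains T where "T \<subseteq> {1..s * m}" "card T = s" "\<And>x. \<exists>c\<in>T. good c x"
proof -
  define T where "T j = {s * j + 1..s * Suc j}" for j
  have "\<exists>j<m. \<forall>x. \<exists>c\<in>T j. good c x"
  proof (rule ccontr)
    assume "\<not> ?thesis"
    then obtain x where x: "\<And>j c. j < m \<Longrightarrow> c \<in> T j \<Longrightarrow> \<not> good c (x j)" by metis
    have "card (x ` {..<m}) \<le> m" using card_image_le[of "{..<m}" x] by simp
    then obtain c where c: "c \<in> {1..s * m}" "\<And>j. j < m \<Longrightarrow> good c (x j)"
      using common[of "x ` {..<m}"] by auto
    define j where "j = (c - 1) div s"
    have "j < m" using c(1) assms(1) unfolding j_def
      by (intro less_mult_imp_div_less) (auto simp: mult.commute)
    moreover have "c \<in> T j"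
    proof -
      have "s * j + (c - 1) mod s = c - 1" "(c - 1) mod s < s"
        using assms(1) unfolding j_def by auto
      then show ?thesis using c(1) unfolding T_def by auto
    qed
    ultimately show False using x c(2) by blast
  qed
  then obtain j where j: "j < m" "\<And>x. \<exists>c\<in>T j. good c x" by blast
  have "s * Suc j \<le> s * m" using j(1) by (intro mult_le_mono2) simp
  then have "T j \<subseteq> {1..s * m}" unfolding T_def by auto
  then show thesis using that[of "T j"] j(2) by (simp add: T_def)
qed

section \<open>Application to the complete \<open>k\<close>-graph\<close>

theorem theorem1p4:
  fixes s k r :: nat and \<phi> :: "nat set \<Rightarrow> nat"
  assumes "s \<ge> 1" and "k \<ge> 2" and "r = s * (k - 1)"
    and "edge_colouring r (complete_k_graph k (UNIV :: nat set)) \<phi>"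
  shows "\<exists>(P :: nat \<Rightarrow> nat path) (c :: nat \<Rightarrow> nat).
    core_partition (UNIV :: nat set) s P \<and>
    (\<forall>i\<in>{1..s}. berge_path (complete_k_graph k (UNIV :: nat set)) (P i) \<and>
                c i \<in> {1..r} \<and> monochromatic_in \<phi> (c i) (P i)) \<and>
    inj_on c {1..s}"
proof -
  let ?H = "complete_k_graph k (UNIV :: nat set)"
  have H: "fst ?H = UNIV" "\<And>e. e \<in> snd ?H \<longleftrightarrow> finite e \<and> card e = k"
    by (auto simp: complete_k_graph_def nsets_def)
  have col: "\<phi> e \<in> {1..r}" if "e \<in> snd ?H" for e
    using assms(4) that by (auto simp: edge_colouring_def)
  define I where "I = {S :: nat set. finite S \<and> card S = k - 1}"
  have edge: "insert y S \<in> snd ?H" if "S \<in> I" "y \<notin> S" for y S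
    using that assms(2) by (simp add: H I_def)
  \<comment> \<open>For \<open>y \<in> S\<close> there is no edge to colour; 0 is a default outside
    the colours \<open>{1..r}\<close>.\<close>
  define h where "h S y = (if y \<in> S then 0 else \<phi> (insert y S))" for S y
  have "countable I" unfolding I_def
    by (rule countable_subset[OF _ countable_Collect_finite]) auto
  moreover have "finite (range (h S))" if "S \<in> I" for S
  proof -
    have "h S y \<in> {0..r}" for y
      using col[OF edge[OF that]] by (auto simp: h_def)
    then show ?thesis by (meson finite_atLeastAtMost finite_subset image_subsetI)
  qed
  ultimately obtain \<sigma> :: "nat \<Rightarrow> nat" where \<sigma>: "strict_mono \<sigma>"
    "\<And>S. S \<in> I \<Longrightarrow> \<exists>c. \<forall>\<^sub>F n in sequentially. h S (\<sigma> n) = c"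
    using eventually_constant_subsequence by blast
  have avoid: "\<forall>\<^sub>F n in sequentially. \<sigma> n \<notin> A" if "finite A" for A
  proof -
    obtain b where "A \<subseteq> {..<b}" using \<open>finite A\<close> finite_nat_iff_bounded by blast
    moreover have "\<forall>\<^sub>F n in sequentially. b \<le> \<sigma> n"
      using eventually_ge_at_top[of b]
      by eventually_elim (use seq_suble[OF \<sigma>(1)] le_trans in blast)
    ultimately show ?thesis by (elim eventually_mono) auto
  qed
  define E where "E c = {e \<in> snd ?H. \<phi> e = c}" for c
  define good where "good c x \<longleftrightarrow> (\<forall>\<^sub>F n in sequentially. \<exists>e \<in> E c. {x, \<sigma> n} \<subseteq> e)" for c x
  have "\<exists>c\<in>{1..s * (k - 1)}. \<forall>x\<in>X. good c x" if X: "finite X" "card X \<le> k - 1" for X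
  proof -
    \<comment> \<open>Pad \<open>X\<close> to exactly \<open>k - 1\<close> vertices, so that one
      further vertex makes an edge.\<close>
    obtain D where D: "D \<subseteq> UNIV - X" "finite D" "card D = k - 1 - card X"
      using infinite_arbitrarily_large[of "UNIV - X"] X by auto
    define S where "S = X \<union> D"
    have "X \<inter> D = {}" using D by blast
    then have S: "S \<in> I" using D X by (simp add: S_def I_def card_Un_disjoint)
    then have "finite S" by (simp add: I_def)
    obtain c where "\<forall>\<^sub>F n in sequentially. h S (\<sigma> n) = c" using \<sigma>(2)[OF S] by blast
    \<comment> \<open>Eventually \<open>\<sigma> n\<close> lies outside \<open>S\<close>, so
      \<open>c\<close> is the colour of actual edges and not the default.\<close>
    then have ev: "\<forall>\<^sub>F n in sequentially. insert (\<sigma> n) S \<in> E c"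
      using avoid[OF \<open>finite S\<close>] by eventually_elim (auto simp: h_def E_def edge S)
    then obtain n where "insert (\<sigma> n) S \<in> E c" by (auto simp: eventually_sequentially)
    then have "c \<in> {1..r}" using col[of "insert (\<sigma> n) S"] by (simp add: E_def)
    moreover have "good c x" if "x \<in> X" for x
    proof -
      have "x \<in> S" using that by (simp add: S_def)
      then show ?thesis unfolding good_def using ev by (auto elim!: eventually_mono)
    qed
    ultimately show ?thesis unfolding assms(3)[symmetric] by blast
  qed
  then obtain T where T: "T \<subseteq> {1..r}" "card T = s" "\<And>x. \<exists>c\<in>T. good c x"
    using small_transversal[OF assms(1), of "k - 1" good] assms(3) by metis
  then obtain g0 where g0: "\<And>x. g0 x \<in> T" "\<And>x. good (g0 x) x" by metis
  have "finite T" using T(1) finite_subset by blast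
  then obtain g where g: "range g = T" "\<And>x z. x \<noteq> z \<Longrightarrow> g x = g z \<Longrightarrow> g0 x = g x \<and> g0 z = g z"
    using surjective_modification[of T g0] g0(1) by auto
  have "(\<exists>e \<in> E (g z) - F. {x, z} \<subseteq> e) \<or>
      (\<exists>y e f. y \<notin> W \<and> e \<in> E (g z) - F \<and> f \<in> E (g z) - F \<and> e \<noteq> f \<and> {x, y} \<subseteq> e \<and> {y, z} \<subseteq> f)"
    if xz: "x \<noteq> z" "g x = g z" and fin: "finite W" "finite F" for x z W F
  proof -
    \<comment> \<open>Sharing a class, \<open>x\<close> and \<open>z\<close> keep their
      \<open>g0\<close>-values, for which goodness is known.\<close>
    have gd: "good (g z) x" "good (g z) z" using g0(2) g(2)[OF xz] xz(2) by metis+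
    \<comment> \<open>An edge through a vertex outside every edge of \<open>F\<close> is not in
      \<open>F\<close>, so avoiding finitely many vertices suffices. The intersection discards
      infinite members of \<open>F\<close>.\<close>
    have "finite (W \<union> \<Union>(F \<inter> snd ?H))" using fin H by auto
    note eventually_conj[OF gd(1)[unfolded good_def]
        eventually_conj[OF gd(2)[unfolded good_def] avoid[OF this]]]
    from eventually_happens'[OF sequentially_bot this]
    obtain n e f where y: "\<sigma> n \<notin> W \<union> \<Union>(F \<inter> snd ?H)" and
      ef: "e \<in> E (g z)" "{x, \<sigma> n} \<subseteq> e" "f \<in> E (g z)" "{z, \<sigma> n} \<subseteq> f"
      by blast
    then have "e \<notin> F" "f \<notin> F" by (auto simp: E_def)
    show ?thesis
    proof (cases "e = f")
      case True
      then have "e \<in> E (g z) - F" "{x, z} \<subseteq> e" using ef \<open>e \<notin> F\<close> by auto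
      then show ?thesis by blast
    next
      case False
      moreover have "e \<in> E (g z) - F" "f \<in> E (g z) - F" "\<sigma> n \<notin> W" "{\<sigma> n, z} \<subseteq> f"
        using ef y \<open>e \<notin> F\<close> \<open>f \<notin> F\<close> by auto
      ultimately show ?thesis using ef(2) by blast
    qed
  qed
  moreover have "finite (range g)" "\<And>c. E c \<subseteq> snd ?H"
    using \<open>finite T\<close> g(1) by (auto simp: E_def)
  ultimately have "\<exists>P. disjoint_family_on (\<lambda>c. fst (P c)) (range g) \<and>
      (\<Union>c\<in>range g. fst (P c)) = UNIV \<and>
      (\<forall>c \<in> range g. berge_path ?H (P c) \<and> snd (P c) \<subseteq> E c)"
    using H(1) by (rule partition_into_berge_paths)
  then obtain P where P: "disjoint_family_on (\<lambda>c. fst (P c)) T" "(\<Union>c\<in>T. fst (P c)) = UNIV"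
    "\<And>c. c \<in> T \<Longrightarrow> berge_path ?H (P c)" "\<And>c. c \<in> T \<Longrightarrow> snd (P c) \<subseteq> E c"
    unfolding g(1) by metis
  \<comment> \<open>The paths are indexed by colours so far; \<open>c\<close> renumbers them by
    \<open>{1..s}\<close>.\<close>
  obtain c where c: "bij_betw c {1..s} T"
    using finite_same_card_bij[of "{1..s}" T] \<open>finite T\<close> T(2) by auto
  then have cT: "c ` {1..s} = T" "inj_on c {1..s}" by (auto simp: bij_betw_def)
  have "core_partition UNIV s (P \<circ> c)"
    unfolding core_partition_def
  proof
    show "disjoint_family_on (\<lambda>i. fst ((P \<circ> c) i)) {1..s}"
      unfolding disjoint_family_on_def
    proof (intro ballI impI)
      fix i j assume ij: "i \<in> {1..s}" "j \<in> {1..s}" "i \<noteq> j"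
      then have "c i \<in> T" "c j \<in> T" "c i \<noteq> c j" using cT by (auto dest: inj_onD)
      then show "fst ((P \<circ> c) i) \<inter> fst ((P \<circ> c) j) = {}"
        using P(1) by (simp add: disjoint_family_on_def)
    qed
    show "(\<Union>i\<in>{1..s}. fst ((P \<circ> c) i)) = UNIV"
      using P(2) unfolding cT(1)[symmetric] by simp
  qed
  moreover have "berge_path ?H ((P \<circ> c) i) \<and> c i \<in> {1..r} \<and> monochromatic_in \<phi> (c i) ((P \<circ> c) i)"
    if "i \<in> {1..s}" for i
  proof -
    have "c i \<in> T" using cT(1) that by blast
    then show ?thesis using P(3,4)[of "c i"] T(1) by (auto simp: monochromatic_in_def E_def)
  qed
  ultimately show ?thesis using cT(2) by blast
qed

end
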